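(* Over the axioms of Hilbert's plane geometry in groups I (incidence), II (order) and III.1--III.4 (congruence without SAS), Euclid's parallel postulate (PP) and the classical Playfair axiom (cPF) are not equivalent. In particular, there exists a geometry $\mathcal{G}$ that satisfies axioms I.1--I.3, II.1--II.4 and III.1--III.4, in which axiom III.5 (SAS) fails, and such that (cPF) holds in $\mathcal{G}$ but (PP) fails in $\mathcal{G}$.
   Context: A geometry consists of a set of points, a set of lines, an incidence relation between points and lines ("lies on"), a ternary betweenness relation on points, a congruence relation $\cong$ between segments, and a congruence relation $\cong$ between angles. A segment is an unordered pair of distinct points $A,B$, written $AB$; its interior points are the points between $A$ and $B$. **Group I (incidence in the plane).** I.1: For any two distinct points there is a line on which both lie. I.2: For any two distinct points there is at most one line on which both lie. I.3: On every line there lie at least two points, and there exist three points not all on one line. **Group II (order).** II.1: If $B$ is between $A$ and $C$, then $A,B,C$ are three distinct points of a line, and $B$ is also between $C$ and $A$. II.2: For any two distinct points $A,C$ there is a point $B$ on line $AC$ such that $C$ is between $A$ and $B$. II.3: Of any three points on a line, at most one is between the other two. II.4 (Pasch): If $A,B,C$ are not collinear and $a$ is a line containing none of $A,B,C$ and containing a point between $A$ and $B$, then $a$ contains a point between $A$ and $C$ or a point between $B$ and $C$. **Derived notions.** Two points not on a line $a$ are on the same side of $a$ if they are equal or no point of $a$ is between them; each line has two sides. For a point $O$ on a line $\bar h$, the points of $\bar h$ other than $O$ split into two rays from $O$ (two points are in the same ray iff $O$ is not between them). An angle $\angle(h,k)=\angle(k,h)$ is an unordered pair of rays $h,k$ from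 a common vertex $O$ lying on distinct lines $\bar h,\bar k$. Thus zero and straight angles are excluded. Its interior is the set of points that are on the same side of $\bar h$ as $k$ and on the same side of $\bar k$ as $h$. For noncollinear $A,B,C$, $\angle BAC$ is the angle formed by the rays from $A$ through $B$ and through $C$. Two angles are supplementary if they have a common vertex and a common side and their other sides are the two opposite rays of one line. **Group III (congruence).** III.1: Given distinct points $A,B$, a line $a'$, a point $A'$ on $a'$, and one of the two rays of $a'$ from $A'$, there is a point $B'$ on that ray with $AB\cong A'B'$. III.2: If $A'B'\cong AB$ and $A''B''\cong AB$, then $A'B'\cong A''B''$. III.3: If $B$ is between $A$ and $C$, $B'$ is between $A'$ and $C'$, $AB\cong A'B'$ and $BC\cong B'C'$, then $AC\cong A'C'$. III.4: Given an angle $\angle(h,k)$, a line $a'$, a side of $a'$, and a ray $h'$ of $a'$ from a point $O'$ of $a'$, there is exactly one ray $k'$ from $O'$ lying on the given side of $a'$ with $\angle(h,k)\cong\angle(h',k')$. Every angle is congruent to itself. III.5 (SAS): If $A,B,C$ are noncollinear, $A',B',C'$ are noncollinear, $AB\cong A'B'$, $AC\cong A'C'$ and $\angle BAC\cong\angle B'A'C'$, then $\angle ABC\cong\angle A'B'C'$. **Parallel axioms.** (cPF): For every line $a$ and every point $A$ not on $a$, there is exactly one line through $A$ that does not intersect $a$. (PP): If a straight line falling on two straight lines makes the interior angles on the same side less than two right angles, then the two straight lines meet on that side. Precisely: let $a,b$ be distinct lines and $t$ a line different from both, meeting $a$ in $A$ and $b$ in $B$ with $A\ne B$, and let $S$ be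 a side of $t$. Let $\alpha$ be the angle with vertex $A$ formed by the ray from $A$ through $B$ and the ray of $a$ from $A$ lying in $S$. Let $\beta$ be the angle with vertex $B$ formed by the ray from $B$ through $A$ and the ray of $b$ from $B$ lying in $S$. If $\alpha$ and $\beta$ together are less than two right angles, then $a$ and $b$ have a common point lying in $S$. Here an angle $\alpha$ is less than an angle $\gamma$ if there is a ray $r$ from the vertex of $\gamma$, lying in the interior of $\gamma$, that forms with one of the sides of $\gamma$ an angle congruent to $\alpha$. Angles $\alpha,\beta$ together are less than two right angles if $\alpha$ is less than every supplementary angle of $\beta$ and $\beta$ is less than every supplementary angle of $\alpha$. *)

theory Defs
  imports Complex_Main
begin

text \<open>
  Segments and angles are unordered pairs: the segment with end points \<open>A\<close>, \<open>B\<close> is \<open>{A, B}\<close>, and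
  the angle with sides \<open>h\<close>, \<open>k\<close> is \<open>{h, k}\<close>, where a ray is the set of its points (its origin
  excluded). All axioms are relativised to the carriers \<open>points\<close> and \<open>lines\<close>; the values of the
  relations outside the carriers, or on sets that are not segments or angles, are irrelevant.
  \<open>btw G A B C\<close> means that \<open>B\<close> is between \<open>A\<close> and \<open>C\<close>.
\<close>

record ('p, 'l) geometry =
  points :: "'p set"
  lines :: "'l set"
  lies_on :: "'p \<Rightarrow> 'l \<Rightarrow> bool"
  btw :: "'p \<Rightarrow> 'p \<Rightarrow> 'p \<Rightarrow> bool"
  seg_cong :: "'p set \<Rightarrow> 'p set \<Rightarrow> bool"
  ang_cong :: "'p set set \<Rightarrow> 'p set set \<Rightarrow> bool"


subsection \<open>Incidence and order\<close>

definition collinear3 :: "('p, 'l) geometry \<Rightarrow> 'p \<Rightarrow> 'p \<Rightarrow> 'p \<Rightarrow> bool" where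
  "collinear3 G A B C \<longleftrightarrow>
     (\<exists>l\<in>lines G. lies_on G A l \<and> lies_on G B l \<and> lies_on G C l)"

definition axiom_I1 :: "('p, 'l) geometry \<Rightarrow> bool" where
  "axiom_I1 G \<longleftrightarrow>
     (\<forall>A\<in>points G. \<forall>B\<in>points G. A \<noteq> B \<longrightarrow> (\<exists>l\<in>lines G. lies_on G A l \<and> lies_on G B l))"

definition axiom_I2 :: "('p, 'l) geometry \<Rightarrow> bool" where
  "axiom_I2 G \<longleftrightarrow>
     (\<forall>A\<in>points G. \<forall>B\<in>points G. \<forall>l\<in>lines G. \<forall>m\<in>lines G.
        A \<noteq> B \<longrightarrow> lies_on G A l \<longrightarrow> lies_on G B l \<longrightarrow> lies_on G A m \<longrightarrow> lies_on G B m \<longrightarrow> l = m)"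

definition axiom_I3 :: "('p, 'l) geometry \<Rightarrow> bool" where
  "axiom_I3 G \<longleftrightarrow>
     (\<forall>l\<in>lines G. \<exists>A\<in>points G. \<exists>B\<in>points G. A \<noteq> B \<and> lies_on G A l \<and> lies_on G B l) \<and>
     (\<exists>A\<in>points G. \<exists>B\<in>points G. \<exists>C\<in>points G. distinct [A, B, C] \<and> \<not> collinear3 G A B C)"

definition axiom_II1 :: "('p, 'l) geometry \<Rightarrow> bool" where
  "axiom_II1 G \<longleftrightarrow>
     (\<forall>A\<in>points G. \<forall>B\<in>points G. \<forall>C\<in>points G.
        btw G A B C \<longrightarrow> distinct [A, B, C] \<and> collinear3 G A B C \<and> btw G C B A)"

definition axiom_II2 :: "('p, 'l) geometry \<Rightarrow> bool" where
  "axiom_II2 G \<longleftrightarrow>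
     (\<forall>A\<in>points G. \<forall>C\<in>points G. A \<noteq> C \<longrightarrow>
        (\<exists>B\<in>points G. collinear3 G A C B \<and> btw G A C B))"

definition axiom_II3 :: "('p, 'l) geometry \<Rightarrow> bool" where
  "axiom_II3 G \<longleftrightarrow>
     (\<forall>A\<in>points G. \<forall>B\<in>points G. \<forall>C\<in>points G.
        distinct [A, B, C] \<longrightarrow> collinear3 G A B C \<longrightarrow>
          \<not> (btw G B A C \<and> btw G A B C) \<and>
          \<not> (btw G B A C \<and> btw G A C B) \<and>
          \<not> (btw G A B C \<and> btw G A C B))"

definition axiom_II4 :: "('p, 'l) geometry \<Rightarrow> bool" where
  "axiom_II4 G \<longleftrightarrow>
     (\<forall>A\<in>points G. \<forall>B\<in>points G. \<forall>C\<in>points G. \<forall>a\<in>lines G.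
        \<not> collinear3 G A B C \<longrightarrow>
        \<not> lies_on G A a \<longrightarrow> \<not> lies_on G B a \<longrightarrow> \<not> lies_on G C a \<longrightarrow>
        (\<exists>P\<in>points G. lies_on G P a \<and> btw G A P B) \<longrightarrow>
        (\<exists>P\<in>points G. lies_on G P a \<and> btw G A P C) \<or>
        (\<exists>P\<in>points G. lies_on G P a \<and> btw G B P C))"


subsection \<open>Sides, rays and angles\<close>

definition same_side :: "('p, 'l) geometry \<Rightarrow> 'l \<Rightarrow> 'p \<Rightarrow> 'p \<Rightarrow> bool" where
  "same_side G a P Q \<longleftrightarrow>
     P \<in> points G \<and> Q \<in> points G \<and> \<not> lies_on G P a \<and> \<not> lies_on G Q a \<and>
     (P = Q \<or> \<not> (\<exists>X\<in>points G. lies_on G X a \<and> btw G P X Q))"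

definition is_side :: "('p, 'l) geometry \<Rightarrow> 'l \<Rightarrow> 'p set \<Rightarrow> bool" where
  "is_side G a S \<longleftrightarrow>
     a \<in> lines G \<and> (\<exists>P\<in>points G. \<not> lies_on G P a \<and> S = {Q. same_side G a P Q})"

text \<open>\<open>is_ray G V l r\<close>: \<open>r\<close> is one of the rays of the line \<open>l\<close> from its point \<open>V\<close>.\<close>

definition is_ray :: "('p, 'l) geometry \<Rightarrow> 'p \<Rightarrow> 'l \<Rightarrow> 'p set \<Rightarrow> bool" where
  "is_ray G V l r \<longleftrightarrow>
     V \<in> points G \<and> l \<in> lines G \<and> lies_on G V l \<and>
     (\<exists>A\<in>points G. A \<noteq> V \<and> lies_on G A l \<and>
        r = {P \<in> points G. lies_on G P l \<and> P \<noteq> V \<and> \<not> btw G A V P})"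

definition ray_thru :: "('p, 'l) geometry \<Rightarrow> 'p \<Rightarrow> 'p \<Rightarrow> 'p set" where
  "ray_thru G V A = {P \<in> points G. collinear3 G V A P \<and> P \<noteq> V \<and> \<not> btw G A V P}"

text \<open>
  \<open>angle_sides G V hl h kl k\<close>: the rays \<open>h\<close> and \<open>k\<close>, of the distinct lines \<open>hl\<close> and \<open>kl\<close>, are the
  sides of an angle with vertex \<open>V\<close>; the angle itself is \<open>{h, k}\<close>.
\<close>

definition angle_sides ::
  "('p, 'l) geometry \<Rightarrow> 'p \<Rightarrow> 'l \<Rightarrow> 'p set \<Rightarrow> 'l \<Rightarrow> 'p set \<Rightarrow> bool" where
  "angle_sides G V hl h kl k \<longleftrightarrow> is_ray G V hl h \<and> is_ray G V kl k \<and> hl \<noteq> kl"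

definition angle_interior :: "('p, 'l) geometry \<Rightarrow> 'p set set \<Rightarrow> 'p set" where
  "angle_interior G \<alpha> =
     {P. \<exists>V hl h kl k. angle_sides G V hl h kl k \<and> \<alpha> = {h, k} \<and>
           (\<forall>K\<in>k. same_side G hl K P) \<and> (\<forall>H\<in>h. same_side G kl H P)}"

text \<open>The angle at the vertex \<open>A\<close>, for \<open>A\<close>, \<open>B\<close>, \<open>C\<close> not collinear.\<close>

definition angle_pts :: "('p, 'l) geometry \<Rightarrow> 'p \<Rightarrow> 'p \<Rightarrow> 'p \<Rightarrow> 'p set set" where
  "angle_pts G B A C = {ray_thru G A B, ray_thru G A C}"

definition supplementary :: "('p, 'l) geometry \<Rightarrow> 'p set set \<Rightarrow> 'p set set \<Rightarrow> bool" where
  "supplementary G \<alpha> \<beta> \<longleftrightarrow>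
     (\<exists>V hl h kl k k'. angle_sides G V hl h kl k \<and> angle_sides G V hl h kl k' \<and> k \<noteq> k' \<and>
        \<alpha> = {h, k} \<and> \<beta> = {h, k'})"


subsection \<open>Congruence\<close>

definition axiom_III1 :: "('p, 'l) geometry \<Rightarrow> bool" where
  "axiom_III1 G \<longleftrightarrow>
     (\<forall>A\<in>points G. \<forall>B\<in>points G. \<forall>a'\<in>lines G. \<forall>A'\<in>points G. \<forall>r.
        A \<noteq> B \<longrightarrow> lies_on G A' a' \<longrightarrow> is_ray G A' a' r \<longrightarrow>
        (\<exists>B'\<in>r. seg_cong G {A, B} {A', B'}))"

definition axiom_III2 :: "('p, 'l) geometry \<Rightarrow> bool" where
  "axiom_III2 G \<longleftrightarrow>
     (\<forall>A\<in>points G. \<forall>B\<in>points G. \<forall>A'\<in>points G. \<forall>B'\<in>points G. \<forall>A''\<in>points G. \<forall>B''\<in>points G.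
        A \<noteq> B \<longrightarrow> A' \<noteq> B' \<longrightarrow> A'' \<noteq> B'' \<longrightarrow>
        seg_cong G {A', B'} {A, B} \<longrightarrow> seg_cong G {A'', B''} {A, B} \<longrightarrow>
        seg_cong G {A', B'} {A'', B''})"

definition axiom_III3 :: "('p, 'l) geometry \<Rightarrow> bool" where
  "axiom_III3 G \<longleftrightarrow>
     (\<forall>A\<in>points G. \<forall>B\<in>points G. \<forall>C\<in>points G. \<forall>A'\<in>points G. \<forall>B'\<in>points G. \<forall>C'\<in>points G.
        btw G A B C \<longrightarrow> btw G A' B' C' \<longrightarrow>
        seg_cong G {A, B} {A', B'} \<longrightarrow> seg_cong G {B, C} {B', C'} \<longrightarrow>
        seg_cong G {A, C} {A', C'})"

definition axiom_III4 :: "('p, 'l) geometry \<Rightarrow> bool" where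
  "axiom_III4 G \<longleftrightarrow>
     (\<forall>V hl h kl k a' S V' h'.
        angle_sides G V hl h kl k \<longrightarrow> is_side G a' S \<longrightarrow> is_ray G V' a' h' \<longrightarrow>
        (\<exists>!k'. (\<exists>l. is_ray G V' l k') \<and> k' \<subseteq> S \<and> ang_cong G {h, k} {h', k'})) \<and>
     (\<forall>V hl h kl k. angle_sides G V hl h kl k \<longrightarrow> ang_cong G {h, k} {h, k})"

definition axiom_III5 :: "('p, 'l) geometry \<Rightarrow> bool" where
  "axiom_III5 G \<longleftrightarrow>
     (\<forall>A\<in>points G. \<forall>B\<in>points G. \<forall>C\<in>points G. \<forall>A'\<in>points G. \<forall>B'\<in>points G. \<forall>C'\<in>points G.
        \<not> collinear3 G A B C \<longrightarrow> \<not> collinear3 G A' B' C' \<longrightarrow>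
        seg_cong G {A, B} {A', B'} \<longrightarrow> seg_cong G {A, C} {A', C'} \<longrightarrow>
        ang_cong G (angle_pts G B A C) (angle_pts G B' A' C') \<longrightarrow>
        ang_cong G (angle_pts G A B C) (angle_pts G A' B' C'))"


subsection \<open>Parallel axioms\<close>

definition cPF :: "('p, 'l) geometry \<Rightarrow> bool" where
  "cPF G \<longleftrightarrow>
     (\<forall>a\<in>lines G. \<forall>A\<in>points G. \<not> lies_on G A a \<longrightarrow>
        (\<exists>!b. b \<in> lines G \<and> lies_on G A b \<and>
              \<not> (\<exists>P\<in>points G. lies_on G P a \<and> lies_on G P b)))"

text \<open>Since \<open>{h, k} = {k, h}\<close>, the ray \<open>r\<close> may be joined to either side of \<open>\<gamma>\<close>.\<close>

definition angle_less :: "('p, 'l) geometry \<Rightarrow> 'p set set \<Rightarrow> 'p set set \<Rightarrow> bool" where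
  "angle_less G \<alpha> \<gamma> \<longleftrightarrow>
     (\<exists>V hl h kl k l r. angle_sides G V hl h kl k \<and> \<gamma> = {h, k} \<and>
        is_ray G V l r \<and> r \<subseteq> angle_interior G \<gamma> \<and> ang_cong G {h, r} \<alpha>)"

definition less_than_two_right :: "('p, 'l) geometry \<Rightarrow> 'p set set \<Rightarrow> 'p set set \<Rightarrow> bool" where
  "less_than_two_right G \<alpha> \<beta> \<longleftrightarrow>
     (\<forall>\<beta>'. supplementary G \<beta> \<beta>' \<longrightarrow> angle_less G \<alpha> \<beta>') \<and>
     (\<forall>\<alpha>'. supplementary G \<alpha> \<alpha>' \<longrightarrow> angle_less G \<beta> \<alpha>')"

definition PP :: "('p, 'l) geometry \<Rightarrow> bool" where
  "PP G \<longleftrightarrow>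
     (\<forall>a\<in>lines G. \<forall>b\<in>lines G. \<forall>t\<in>lines G. \<forall>A\<in>points G. \<forall>B\<in>points G. \<forall>S ra rb.
        a \<noteq> b \<longrightarrow> t \<noteq> a \<longrightarrow> t \<noteq> b \<longrightarrow>
        lies_on G A a \<longrightarrow> lies_on G A t \<longrightarrow> lies_on G B b \<longrightarrow> lies_on G B t \<longrightarrow> A \<noteq> B \<longrightarrow>
        is_side G t S \<longrightarrow>
        is_ray G A a ra \<longrightarrow> ra \<subseteq> S \<longrightarrow>
        is_ray G B b rb \<longrightarrow> rb \<subseteq> S \<longrightarrow>
        less_than_two_right G {ray_thru G A B, ra} {ray_thru G B A, rb} \<longrightarrow>
        (\<exists>P\<in>S. lies_on G P a \<and> lies_on G P b))"


definition satisfies_I_II_III14 :: "('p, 'l) geometry \<Rightarrow> bool" where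
  "satisfies_I_II_III14 G \<longleftrightarrow>
     axiom_I1 G \<and> axiom_I2 G \<and> axiom_I3 G \<and>
     axiom_II1 G \<and> axiom_II2 G \<and> axiom_II3 G \<and> axiom_II4 G \<and>
     axiom_III1 G \<and> axiom_III2 G \<and> axiom_III3 G \<and> axiom_III4 G"

end

theory Submission
  imports Defs "HOL-Analysis.Euclidean_Space"
begin

text \<open>
  The model is the real affine plane with its usual order and Euclidean congruence of segments. An
  angle with vertex \<open>V\<close> is measured by the Euclidean cotangent, multiplied by \<open>2\<close> if \<open>V\<close> is the
  origin. The cotangent maps the rays on a given side of a given line bijectively onto the reals, and
  so does the distorted one, which gives III.4. The distortion makes an acute angle at the origin
  smaller and the supplementary obtuse angle larger. Hence if \<open>a\<close> and \<open>b\<close> are parallel, \<open>a\<close> passes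
  through the origin and the interior angle there is acute, then both interior angles on that side
  are together less than two right angles.
\<close>

section \<open>Vectors of the plane\<close>

text \<open>Points are pairs; a quantifier over points should stay one quantifier instead of being
  split into coordinates.\<close>

declare split_paired_Ex [simp del] split_paired_All [simp del]

text \<open>The determinant of \<open>u\<close> and \<open>v\<close>; its sign tells to which side
  of the direction \<open>u\<close> the vector \<open>v\<close> points.\<close>

definition cross :: "real \<times> real \<Rightarrow> real \<times> real \<Rightarrow> real" where
  "cross u v = fst u * snd v - snd u * fst v"

definition perp :: "real \<times> real \<Rightarrow> real \<times> real" where
  "perp u = (- snd u, fst u)"

lemma cross_simps [simp]:
  "cross u u = 0" "cross u 0 = 0" "cross 0 u = 0"
  "cross u (v + w) = cross u v + cross u w" "cross u (v - w) = cross u v - cross u w"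
  "cross (v + w) u = cross v u + cross w u" "cross (v - w) u = cross v u - cross w u"
  "cross u (c *\<^sub>R v) = c * cross u v" "cross (c *\<^sub>R u) v = c * cross u v"
  "cross u (- v) = - cross u v" "cross (- u) v = - cross u v"
  by (simp_all add: cross_def algebra_simps)

lemma cross_commute: "cross v u = - cross u v"
  by (simp add: cross_def)

lemma cross_perp [simp]: "cross u (perp v) = inner u v"
  by (simp add: cross_def perp_def inner_prod_def)

lemma inner_perp [simp]: "inner u (perp v) = - cross u v"
  by (simp add: cross_def perp_def inner_prod_def)

lemma cross_eq_0_cases:
  assumes "cross u w = 0" "u \<noteq> 0"
  obtains t where "w = t *\<^sub>R u"
proof -
  obtain a b c d where [simp]: "u = (a, b)" "w = (c, d)" by (metis surj_pair)
  have *: "a * d = b * c" using assms by (simp add: cross_def)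
  show thesis
  proof (cases "a = 0")
    case True
    then have "b \<noteq> 0" using assms by (simp add: zero_prod_def)
    then show thesis using * True by (intro that[of "d / b"]) simp
  next
    case False
    then show thesis using * by (intro that[of "c / a"]) (simp add: field_simps)
  qed
qed

text \<open>Expansion of \<open>w\<close> in the orthogonal basis \<open>u\<close>,
  \<open>perp u\<close>, cleared of the denominator \<open>inner u u\<close>.\<close>

lemma perp_decomposition:
  "inner u u *\<^sub>R w = inner u w *\<^sub>R u + cross u w *\<^sub>R perp u"
  by (cases u; cases w) (simp add: cross_def perp_def algebra_simps)


section \<open>Lines, half-planes and rays\<close>

text \<open>Lines are point sets, so one line has many descriptions. For \<open>u = 0\<close> this
  is the whole plane, which is why lines ask for \<open>u\<close> nonzero.\<close>

definition line_at :: "real \<times> real \<Rightarrow> real \<times> real \<Rightarrow> (real \<times> real) set" where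
  "line_at V u = {X. cross u (X - V) = 0}"

definition ray_at :: "real \<times> real \<Rightarrow> real \<times> real \<Rightarrow> (real \<times> real) set" where
  "ray_at V u = {X. \<exists>t>0. X = V + t *\<^sub>R u}"

text \<open>The condition on \<open>A\<close> and \<open>C\<close> rules out the degenerate case
  where all three points coincide.\<close>

definition between :: "real \<times> real \<Rightarrow> real \<times> real \<Rightarrow> real \<times> real \<Rightarrow> bool" where
  "between A B C \<longleftrightarrow> A \<noteq> C \<and> (\<exists>t. 0 < t \<and> t < 1 \<and> B = A + t *\<^sub>R (C - A))"

lemma line_at_base [simp]: "V \<in> line_at V u"
  by (simp add: line_at_def)

lemma line_at_scale: "c \<noteq> 0 \<Longrightarrow> line_at V (c *\<^sub>R u) = line_at V u"
  by (simp add: line_at_def)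

lemma line_at_shift:
  assumes "P \<in> line_at V u"
  shows "line_at P u = line_at V u"
  using assms by (auto simp: line_at_def)

lemma line_at_add: "V + t *\<^sub>R u \<in> line_at V u"
  by (simp add: line_at_def)

lemma line_at_obtain:
  assumes "X \<in> line_at V u" "u \<noteq> 0"
  obtains t where "X = V + t *\<^sub>R u"
proof -
  have "cross u (X - V) = 0" using assms(1) by (simp only: line_at_def mem_Collect_eq)
  then obtain t where "X - V = t *\<^sub>R u" using assms(2) by (rule cross_eq_0_cases)
  then have "X = V + t *\<^sub>R u" by (simp add: algebra_simps)
  then show thesis by (rule that)
qed

text \<open>Brings every line through \<open>A\<close> and \<open>B\<close> into one form that
  depends on \<open>A\<close> and \<open>B\<close> alone; uniqueness of the joining line
  follows.\<close>

lemma line_at_two_points: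
  assumes "u \<noteq> 0" "A \<in> line_at V u" "B \<in> line_at V u" "A \<noteq> B"
  shows "line_at V u = line_at A (B - A)"
proof -
  have eq: "line_at A u = line_at V u" using assms(2) by (rule line_at_shift)
  then obtain t where t: "B = A + t *\<^sub>R u" using line_at_obtain assms by metis
  then have "t \<noteq> 0" using assms by auto
  then show ?thesis using t eq line_at_scale by simp
qed

lemma line_at_eq_cross:
  assumes "line_at V u = line_at V w" "w \<noteq> 0"
  shows "cross u w = 0"
proof -
  have "V + 1 *\<^sub>R w \<in> line_at V u" using assms line_at_add by blast
  then show ?thesis by (simp add: line_at_def)
qed

lemma line_at_meet:
  assumes "cross u w \<noteq> 0"
  shows "\<exists>X. X \<in> line_at V u \<and> X \<in> line_at A w"
proof -
  \<comment> \<open>The coefficient solves \<open>cross u (X - V) = 0\<close> for a point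
    \<open>X\<close> of the second line.\<close>
  define X where "X = A + (cross u (V - A) / cross u w) *\<^sub>R w"
  have "X \<in> line_at V u" using assms by (simp add: X_def line_at_def)
  moreover have "X \<in> line_at A w" by (simp add: X_def line_at_add)
  ultimately show ?thesis by blast
qed

text \<open>The map from \<open>X\<close> to \<open>cross u (X - V)\<close> is affine and vanishes
  exactly on the line, so a segment crosses the line iff the values at its ends have opposite
  signs.\<close>

lemma between_line:
  assumes "P \<notin> line_at V u" "Q \<notin> line_at V u"
  shows "(\<exists>X. X \<in> line_at V u \<and> between P X Q) \<longleftrightarrow> cross u (P - V) * cross u (Q - V) < 0"
    (is "_ \<longleftrightarrow> ?p * ?q < 0")
proof
  have nz: "?p \<noteq> 0" "?q \<noteq> 0" using assms by (auto simp: line_at_def)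
  assume "\<exists>X. X \<in> line_at V u \<and> between P X Q"
  then obtain t where t: "0 < t" "t < 1" "P + t *\<^sub>R (Q - P) \<in> line_at V u"
    unfolding between_def by blast
  then have "(1 - t) * ?p = - t * ?q" by (simp add: line_at_def algebra_simps)
  then have "(1 - t) * (?p * ?q) = - t * (?q * ?q)" by (metis mult.assoc)
  also have "\<dots> < 0"
  proof -
    have "?q * ?q > 0" using nz(2) by (metis not_real_square_gt_zero)
    then show ?thesis using t by (simp only: mult_minus_left neg_less_0_iff_less mult_pos_pos)
  qed
  finally show "?p * ?q < 0" using t by (simp add: mult_less_0_iff)
next
  assume neg: "?p * ?q < 0"
  \<comment> \<open>The parameter at which the linear interpolation from \<open>?p\<close> to
    \<open>?q\<close> vanishes.\<close>
  define t where "t = ?p / (?p - ?q)"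
  have ne: "?p - ?q \<noteq> 0" using neg by (metis eq_iff_diff_eq_0 not_square_less_zero)
  have "0 < t" "t < 1"
    using neg by (auto simp: t_def mult_less_0_iff zero_less_divide_iff divide_less_eq)
  moreover have "P + t *\<^sub>R (Q - P) \<in> line_at V u"
  proof -
    have "t * (?p - ?q) = ?p" using ne by (simp add: t_def)
    then show ?thesis by (simp add: line_at_def algebra_simps)
  qed
  moreover have "P \<noteq> Q" using ne by auto
  ultimately show "\<exists>X. X \<in> line_at V u \<and> between P X Q" unfolding between_def by blast
qed

text \<open>\<open>V\<close> has parameter 0 on this line, and 0 lies strictly between two
  parameters iff their signs differ.\<close>

lemma between_opposite:
  assumes "u \<noteq> 0" "s \<noteq> 0"
  shows "between (V + s *\<^sub>R u) V (V + t *\<^sub>R u) \<longleftrightarrow> s * t < 0"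
proof
  assume "between (V + s *\<^sub>R u) V (V + t *\<^sub>R u)"
  then obtain r where r: "0 < r" "r < 1" "V = V + s *\<^sub>R u + r *\<^sub>R (V + t *\<^sub>R u - (V + s *\<^sub>R u))"
    by (auto simp: between_def)
  then have "(s + r * (t - s)) *\<^sub>R u = 0" by (simp add: algebra_simps)
  then have "s + r * (t - s) = 0" using assms by (metis scaleR_eq_0_iff)
  then have "r * t = - ((1 - r) * s)" by (simp add: algebra_simps)
  then have "s * (r * t) = s * - ((1 - r) * s)" by simp
  then have "r * (s * t) = - ((1 - r) * (s * s))" by (simp add: ac_simps)
  also have "\<dots> < 0"
  proof -
    have "s * s > 0" using assms(2) by (metis not_real_square_gt_zero)
    then show ?thesis using r(2) by simp
  qed
  finally show "s * t < 0" using r by (simp add: mult_less_0_iff)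
next
  assume neg: "s * t < 0"
  define r where "r = s / (s - t)"
  have ne: "s - t \<noteq> 0" using neg by (metis eq_iff_diff_eq_0 not_square_less_zero)
  have "0 < r" "r < 1"
    using neg by (auto simp: r_def mult_less_0_iff zero_less_divide_iff divide_less_eq)
  moreover have "V = V + s *\<^sub>R u + r *\<^sub>R (V + t *\<^sub>R u - (V + s *\<^sub>R u))"
  proof -
    have "s + r * (t - s) = 0" using ne by (simp add: r_def field_simps)
    then have "(s + r * (t - s)) *\<^sub>R u = 0" by simp
    then show ?thesis by (simp add: algebra_simps)
  qed
  moreover have "V + s *\<^sub>R u \<noteq> V + t *\<^sub>R u" using ne assms by auto
  ultimately show "between (V + s *\<^sub>R u) V (V + t *\<^sub>R u)" unfolding between_def by blast
qed

lemma ray_at_mem: "t > 0 \<Longrightarrow> V + t *\<^sub>R u \<in> ray_at V u"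
  unfolding ray_at_def by blast

lemma ray_at_scale:
  assumes "c > 0"
  shows "ray_at V (c *\<^sub>R u) = ray_at V u"
proof -
  have "\<exists>s>0. V + t *\<^sub>R u = V + s *\<^sub>R c *\<^sub>R u" if "t > 0" for t
    using that assms by (intro exI[of _ "t / c"]) auto
  moreover have "\<exists>s>0. V + t *\<^sub>R c *\<^sub>R u = V + s *\<^sub>R u" if "t > 0" for t
    using that assms by (intro exI[of _ "t * c"]) auto
  ultimately show ?thesis unfolding ray_at_def by fastforce
qed

text \<open>A ray, although only a point set, determines its origin, and its direction up to a
  positive factor. Hence angles, as sets of rays, have a well-defined measure.\<close>

lemma ray_at_eq_iff:
  assumes "u \<noteq> 0" "w \<noteq> 0"
  shows "ray_at V u = ray_at W w \<longleftrightarrow> V = W \<and> (\<exists>c>0. w = c *\<^sub>R u)"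
proof
  assume eq: "ray_at V u = ray_at W w"
  \<comment> \<open>Two points of the second ray suffice to place both rays on one line.\<close>
  have "W + 1 *\<^sub>R w \<in> ray_at V u" "W + 2 *\<^sub>R w \<in> ray_at V u"
    unfolding eq by (rule ray_at_mem, simp)+
  then obtain s t where st: "W + 1 *\<^sub>R w = V + s *\<^sub>R u" "W + 2 *\<^sub>R w = V + t *\<^sub>R u"
    unfolding ray_at_def mem_Collect_eq by (elim exE conjE)
  define c where "c = t - s"
  have w: "w = c *\<^sub>R u"
  proof -
    have "w = (W + 2 *\<^sub>R w) - (W + 1 *\<^sub>R w)" by (simp add: scaleR_2)
    also have "\<dots> = c *\<^sub>R u" unfolding st c_def by (simp add: algebra_simps)
    finally show ?thesis .
  qed
  have W: "W = V + (s - c) *\<^sub>R u"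
    using st(1) unfolding w by (simp add: algebra_simps)
  have c0: "c \<noteq> 0" using w assms by auto
  \<comment> \<open>In parameters along \<open>u\<close>, equality of the rays says that the
    positive reals are the open half-line starting at \<open>s - c\<close> with the sign of
    \<open>c\<close> as its direction.\<close>
  have key: "x > 0 \<longleftrightarrow> (\<exists>y>0. x = (s - c) + y * c)" for x
  proof -
    have "x > 0 \<longleftrightarrow> V + x *\<^sub>R u \<in> ray_at V u" using assms by (auto simp: ray_at_def)
    also have "\<dots> \<longleftrightarrow> (\<exists>y>0. V + x *\<^sub>R u = V + ((s - c) + y * c) *\<^sub>R u)"
      unfolding eq by (simp add: ray_at_def W w algebra_simps)
    also have "\<dots> \<longleftrightarrow> (\<exists>y>0. x = (s - c) + y * c)" using assms by simp
    finally show ?thesis .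
  qed
  \<comment> \<open>For negative \<open>c\<close> the second half-line is bounded above by
    \<open>s - c\<close>, but the first is unbounded.\<close>
  have cpos: "c > 0"
  proof (rule ccontr)
    assume "\<not> c > 0"
    then have "c < 0" using c0 by simp
    obtain y where "y > 0" "\<bar>s - c\<bar> + 1 = (s - c) + y * c" using key[of "\<bar>s - c\<bar> + 1"] by auto
    moreover from this have "y * c < 0" using \<open>c < 0\<close> by (simp add: mult_pos_neg)
    ultimately show False by linarith
  qed
  \<comment> \<open>If the end points 0 and \<open>s - c\<close> differed, their midpoint would lie
    in just one of the two half-lines.\<close>
  have "s - c = 0"
  proof (rule ccontr)
    assume ne: "s - c \<noteq> 0"
    show False
    proof (cases "s - c > 0")
      case True
      then obtain y where y: "y > 0" "(s - c) / 2 = (s - c) + y * c" using key[of "(s - c) / 2"] by auto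
      have "y * c > 0" using y cpos by simp
      then have "(s - c) / 2 > s - c" using y(2) by linarith
      then show False using True by simp
    next
      case False
      define y where "y = (c - s) / (2 * c)"
      have "y > 0" using False ne cpos by (simp add: y_def)
      then have "(s - c) + y * c > 0" using key by blast
      moreover have "y * c = (c - s) / 2" using cpos by (simp add: y_def)
      ultimately have "(s - c) / 2 > 0" by (simp add: field_simps)
      then show False using False by simp
    qed
  qed
  then show "V = W \<and> (\<exists>c>0. w = c *\<^sub>R u)" using W w cpos by auto
next
  assume "V = W \<and> (\<exists>c>0. w = c *\<^sub>R u)"
  then show "ray_at V u = ray_at W w" using ray_at_scale by metis
qed

text \<open>Links the order-theoretic description of a ray (points not separated by \<open>V\<close>
  from a given point) with the parametric one.\<close>

lemma line_at_ray_diff: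
  assumes "u \<noteq> 0" "s \<noteq> 0"
  shows "{P \<in> line_at V u. P \<noteq> V \<and> \<not> between (V + s *\<^sub>R u) V P} = ray_at V (s *\<^sub>R u)"
proof (intro set_eqI iffI)
  fix P assume "P \<in> {P \<in> line_at V u. P \<noteq> V \<and> \<not> between (V + s *\<^sub>R u) V P}"
  then have P: "P \<in> line_at V u" "P \<noteq> V" "\<not> between (V + s *\<^sub>R u) V P" by auto
  obtain t where t: "P = V + t *\<^sub>R u" using P assms by (metis line_at_obtain)
  then have "t \<noteq> 0" "\<not> s * t < 0" using P assms between_opposite by auto
  then have "t / s > 0" using assms by (auto simp: zero_less_divide_iff mult_less_0_iff)
  moreover have "P = V + (t / s) *\<^sub>R s *\<^sub>R u" using t assms by simp
  ultimately show "P \<in> ray_at V (s *\<^sub>R u)" unfolding ray_at_def by blast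
next
  fix P assume "P \<in> ray_at V (s *\<^sub>R u)"
  then obtain r where r: "r > 0" "P = V + (r * s) *\<^sub>R u" by (auto simp: ray_at_def)
  have "s * (r * s) = r * (s * s)" by simp
  then have "\<not> s * (r * s) < 0" using r by (metis mult_less_0_iff not_square_less_zero not_less_iff_gr_or_eq)
  then show "P \<in> {P \<in> line_at V u. P \<noteq> V \<and> \<not> between (V + s *\<^sub>R u) V P}"
    using r assms between_opposite[of u s V "r * s"] line_at_add[of V "r * s" u] by simp
qed


section \<open>Angle measure\<close>

text \<open>The cotangent of the unoriented angle between \<open>u\<close> and \<open>v\<close>. It
  decreases as the angle grows.\<close>

definition cot_vec :: "real \<times> real \<Rightarrow> real \<times> real \<Rightarrow> real" where
  "cot_vec u v = inner u v / \<bar>cross u v\<bar>"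

definition weight :: "real \<times> real \<Rightarrow> real" where
  "weight V = (if V = 0 then 2 else 1)"

text \<open>A relation, since vertex and directions must be recovered from a bare set of two rays.
  Sets that are not angles have no measure.\<close>

definition has_measure :: "(real \<times> real) set set \<Rightarrow> real \<Rightarrow> bool" where
  "has_measure \<alpha> m \<longleftrightarrow>
     (\<exists>V u v. cross u v \<noteq> 0 \<and> \<alpha> = {ray_at V u, ray_at V v} \<and> m = weight V * cot_vec u v)"

lemma weight_pos [simp]: "weight V > 0" "weight V \<noteq> 0"
  by (simp_all add: weight_def)

lemma cot_vec_commute: "cot_vec v u = cot_vec u v"
  by (simp add: cot_vec_def inner_commute cross_commute[of v u])

lemma cot_vec_scale:
  assumes "c > 0" "d > 0"
  shows "cot_vec (c *\<^sub>R u) (d *\<^sub>R v) = cot_vec u v"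
  using assms by (simp add: cot_vec_def abs_mult)

lemma cross_nz_D: "cross u v \<noteq> 0 \<Longrightarrow> u \<noteq> 0 \<and> v \<noteq> 0"
  by auto

text \<open>The rays fix the vertex, and the directions up to positive factors and order;
  \<open>cot_vec\<close> ignores both.\<close>

lemma has_measure_ray_at:
  assumes "cross u v \<noteq> 0"
  shows "has_measure {ray_at V u, ray_at V v} m \<longleftrightarrow> m = weight V * cot_vec u v"
proof
  assume "has_measure {ray_at V u, ray_at V v} m"
  then obtain W a b where W: "cross a b \<noteq> 0" "m = weight W * cot_vec a b"
    "{ray_at V u, ray_at V v} = {ray_at W a, ray_at W b}"
    unfolding has_measure_def by metis
  have nz: "u \<noteq> 0" "v \<noteq> 0" "a \<noteq> 0" "b \<noteq> 0" using assms W(1) cross_nz_D by blast+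
  from W(3) consider "ray_at V u = ray_at W a" "ray_at V v = ray_at W b"
    | "ray_at V u = ray_at W b" "ray_at V v = ray_at W a"
    unfolding doubleton_eq_iff by blast
  then show "m = weight V * cot_vec u v"
  proof cases
    case 1
    then obtain c d where "V = W" "c > 0" "a = c *\<^sub>R u" "d > 0" "b = d *\<^sub>R v"
      using ray_at_eq_iff nz by auto
    then show ?thesis using W cot_vec_scale by auto
  next
    case 2
    then obtain c d where "V = W" "c > 0" "b = c *\<^sub>R u" "d > 0" "a = d *\<^sub>R v"
      using ray_at_eq_iff nz by auto
    then show ?thesis using W cot_vec_scale cot_vec_commute by metis
  qed
qed (use assms in \<open>auto simp: has_measure_def\<close>)

text \<open>A direction with cotangent \<open>m\<close> against \<open>u\<close>, on the side of
  \<open>u\<close> given by the sign \<open>s\<close>; thus a right inverse of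
  \<open>cot_vec u\<close>.\<close>

definition ray_dir :: "real \<times> real \<Rightarrow> real \<Rightarrow> real \<Rightarrow> real \<times> real" where
  "ray_dir u s m = m *\<^sub>R u + s *\<^sub>R perp u"

lemma cross_ray_dir: "cross u (ray_dir u s m) = s * inner u u"
  by (simp add: ray_dir_def)

lemma cot_vec_ray_dir:
  assumes "u \<noteq> 0" "\<bar>s\<bar> = 1"
  shows "cot_vec u (ray_dir u s m) = m"
proof -
  have "inner u u > 0" using assms by simp
  moreover have "inner u (ray_dir u s m) = m * inner u u"
    by (simp add: ray_dir_def inner_add_right)
  ultimately show ?thesis using assms by (simp add: cot_vec_def cross_ray_dir abs_mult)
qed

text \<open>On a fixed side the cotangent determines the ray: in the expansion of \<open>w\<close>
  in \<open>u\<close> and \<open>perp u\<close>, division by the positive number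
  \<open>\<bar>cross u w\<bar>\<close> turns the coefficients into the cotangent and
  \<open>s\<close>.\<close>

lemma ray_at_ray_dir:
  assumes "s * cross u w > 0" "\<bar>s\<bar> = 1"
  shows "ray_at V w = ray_at V (ray_dir u s (cot_vec u w))"
proof -
  have u: "inner u u > 0" using assms by auto
  define k where "k = \<bar>cross u w\<bar>"
  have k: "k > 0" "cross u w = k * s"
    using assms by (auto simp: k_def abs_if zero_less_mult_iff split: if_splits)
  have "inner u u *\<^sub>R w = k *\<^sub>R ray_dir u s (cot_vec u w)"
    unfolding perp_decomposition[of u w] ray_dir_def cot_vec_def k_def[symmetric] k(2)
    using k(1) assms(2) by (simp add: scaleR_add_right abs_mult)
  then show ?thesis using ray_at_scale u k by metis
qed


section \<open>The geometry\<close>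

definition distorted_plane :: "(real \<times> real, (real \<times> real) set) geometry" where
  "distorted_plane =
     \<lparr>points = UNIV, lines = {line_at V u |V u. u \<noteq> 0}, lies_on = (\<in>), btw = between,
      seg_cong = (\<lambda>s s'. \<exists>A B A' B'. s = {A, B} \<and> s' = {A', B'} \<and> dist A B = dist A' B'),
      ang_cong = (\<lambda>\<alpha> \<beta>. \<exists>m. has_measure \<alpha> m \<and> has_measure \<beta> m)\<rparr>"

abbreviation "G0 \<equiv> distorted_plane"

lemma plane_simps [simp]:
  "points G0 = UNIV" "lines G0 = {line_at V u |V u. u \<noteq> 0}" "lies_on G0 P l \<longleftrightarrow> P \<in> l"
  "btw G0 = between"
  by (simp_all add: distorted_plane_def)

section \<open>The notions of the geometry in coordinates\<close>

lemma seg_cong_plane: "seg_cong G0 {A, B} {A', B'} \<longleftrightarrow> dist A B = dist A' B'"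
  unfolding distorted_plane_def by (simp add: doubleton_eq_iff) (metis dist_commute)

lemma ang_cong_plane: "ang_cong G0 \<alpha> \<beta> \<longleftrightarrow> (\<exists>m. has_measure \<alpha> m \<and> has_measure \<beta> m)"
  by (simp add: distorted_plane_def)

lemma line_at_in_lines: "u \<noteq> 0 \<Longrightarrow> line_at V u \<in> lines G0"
  unfolding plane_simps by blast

lemma line_obtain:
  assumes "l \<in> lines G0" "A \<in> l"
  obtains u where "u \<noteq> 0" "l = line_at A u"
  using assms line_at_shift unfolding plane_simps by blast

lemma collinear3_plane: "collinear3 G0 A B C \<longleftrightarrow> cross (B - A) (C - A) = 0"
proof
  assume "collinear3 G0 A B C"
  then obtain V u where l: "u \<noteq> 0" "A \<in> line_at V u" "B \<in> line_at V u" "C \<in> line_at V u"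
    by (auto simp: collinear3_def)
  then obtain s t where "B = A + s *\<^sub>R u" "C = A + t *\<^sub>R u"
    using line_at_shift line_at_obtain by metis
  then show "cross (B - A) (C - A) = 0" by simp
next
  assume 0: "cross (B - A) (C - A) = 0"
  have "\<exists>u. u \<noteq> 0 \<and> cross u (B - A) = 0 \<and> cross u (C - A) = 0"
  proof (cases "B = A")
    case True
    show ?thesis
    proof (cases "C = A")
      case False
      then show ?thesis using True by (intro exI[of _ "C - A"]) auto
    next
      case True
      \<comment> \<open>All three points coincide, so any nonzero direction will do.\<close>
      have "(1, 1) \<noteq> (0 :: real \<times> real)" by (simp add: prod_eq_iff)
      then show ?thesis using \<open>B = A\<close> True by (metis cross_simps(2) diff_self)
    qed
  next
    case False
    then show ?thesis using 0 by (intro exI[of _ "B - A"]) auto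
  qed
  then obtain u where u: "u \<noteq> 0" "cross u (B - A) = 0" "cross u (C - A) = 0" by blast
  have "line_at A u \<in> lines G0" using u by auto
  moreover have "A \<in> line_at A u" "B \<in> line_at A u" "C \<in> line_at A u" using u by (simp_all add: line_at_def)
  ultimately show "collinear3 G0 A B C" unfolding collinear3_def plane_simps(3) by blast
qed

text \<open>A positive product says at once that neither point is on the line and that the line does
  not separate them.\<close>

lemma same_side_plane:
  "same_side G0 (line_at V u) P Q \<longleftrightarrow> cross u (P - V) * cross u (Q - V) > 0"
proof -
  have "same_side G0 (line_at V u) P Q \<longleftrightarrow> P \<notin> line_at V u \<and> Q \<notin> line_at V u \<and>
      (P = Q \<or> \<not> cross u (P - V) * cross u (Q - V) < 0)"
    using between_line[of P V u Q] unfolding same_side_def by (simp del: cross_simps) blast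
  then show ?thesis
    by (auto simp: line_at_def zero_less_mult_iff mult_less_0_iff)
qed

text \<open>Encodes a side by a sign \<open>s\<close>, the form in which \<open>ray_dir\<close>
  takes it.\<close>

lemma is_side_plane:
  assumes "is_side G0 (line_at V u) S"
  obtains s :: real where "\<bar>s\<bar> = 1" "S = {X. s * cross u (X - V) > 0}"
proof -
  obtain P where P: "P \<notin> line_at V u" "S = {Q. cross u (P - V) * cross u (Q - V) > 0}"
    using assms by (auto simp: is_side_def same_side_plane)
  have "cross u (P - V) \<noteq> 0" using P by (auto simp: line_at_def)
  then show thesis
    by (intro that[of "sgn (cross u (P - V))"])
      (auto simp: P(2) sgn_if zero_less_mult_iff)
qed

lemma is_ray_plane:
  "is_ray G0 V l r \<longleftrightarrow> (\<exists>u. u \<noteq> 0 \<and> l = line_at V u \<and> r = ray_at V u)"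
proof
  assume "is_ray G0 V l r"
  then obtain A where A: "l \<in> lines G0" "V \<in> l" "A \<noteq> V" "A \<in> l"
    "r = {P \<in> l. P \<noteq> V \<and> \<not> between A V P}"
    by (auto simp: is_ray_def)
  obtain u where u: "u \<noteq> 0" "l = line_at V u" using A line_obtain by blast
  have "l = line_at V (A - V)" using u A line_at_two_points by simp
  moreover from this have "r = ray_at V (A - V)"
    using A line_at_ray_diff[of "A - V" 1 V] by simp
  ultimately show "\<exists>u. u \<noteq> 0 \<and> l = line_at V u \<and> r = ray_at V u"
    using A by (intro exI[of _ "A - V"]) auto
next
  assume "\<exists>u. u \<noteq> 0 \<and> l = line_at V u \<and> r = ray_at V u"
  then obtain u where u: "u \<noteq> 0" "l = line_at V u" "r = ray_at V u" by blast
  have "V + u \<in> l" using line_at_add[of V 1 u] u by simp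
  moreover have "r = {P \<in> l. P \<noteq> V \<and> \<not> between (V + u) V P}"
    using line_at_ray_diff[of u 1 V] u by simp
  moreover have "V + u \<noteq> V" using u by simp
  moreover have "l \<in> lines G0" "V \<in> l" using u by auto
  ultimately show "is_ray G0 V l r" unfolding is_ray_def plane_simps(1,3,4) by blast
qed

lemma ray_thru_plane:
  assumes "A \<noteq> V"
  shows "ray_thru G0 V A = ray_at V (A - V)"
proof -
  have "ray_thru G0 V A = {P \<in> line_at V (A - V). P \<noteq> V \<and> \<not> between A V P}"
    by (auto simp: ray_thru_def collinear3_plane line_at_def)
  then show ?thesis using line_at_ray_diff[of "A - V" 1 V] assms by simp
qed

lemma angle_sides_plane:
  "angle_sides G0 V hl h kl k \<longleftrightarrow>
     (\<exists>u v. cross u v \<noteq> 0 \<and> hl = line_at V u \<and> h = ray_at V u \<and> kl = line_at V v \<and> k = ray_at V v)"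
proof
  assume "angle_sides G0 V hl h kl k"
  then have rays: "is_ray G0 V hl h" "is_ray G0 V kl k" "hl \<noteq> kl"
    unfolding angle_sides_def by simp_all
  obtain u where u: "u \<noteq> 0" "hl = line_at V u" "h = ray_at V u"
    using rays(1) unfolding is_ray_plane by (elim exE conjE)
  obtain v where v: "v \<noteq> 0" "kl = line_at V v" "k = ray_at V v"
    using rays(2) unfolding is_ray_plane by (elim exE conjE)
  note uv = u v rays(3)
  have "cross u v \<noteq> 0"
  proof
    assume "cross u v = 0"
    then obtain t where "v = t *\<^sub>R u" using uv cross_eq_0_cases by metis
    moreover have "t \<noteq> 0" using \<open>v = t *\<^sub>R u\<close> v(1) by auto
    ultimately show False using uv line_at_scale by simp
  qed
  then show "\<exists>u v. cross u v \<noteq> 0 \<and> hl = line_at V u \<and> h = ray_at V u \<and> kl = line_at V v \<and> k = ray_at V v"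
    using uv by (intro exI[of _ u] exI[of _ v]) simp
next
  assume "\<exists>u v. cross u v \<noteq> 0 \<and> hl = line_at V u \<and> h = ray_at V u \<and> kl = line_at V v \<and> k = ray_at V v"
  then obtain u v where uv: "cross u v \<noteq> 0"
    "hl = line_at V u" "h = ray_at V u" "kl = line_at V v" "k = ray_at V v"
    by (elim exE conjE)
  have nz: "u \<noteq> 0" "v \<noteq> 0" using uv(1) by auto
  have "hl \<noteq> kl" using uv nz line_at_eq_cross by metis
  moreover have "is_ray G0 V hl h" unfolding is_ray_plane using nz uv by (intro exI[of _ u]) simp
  moreover have "is_ray G0 V kl k" unfolding is_ray_plane using nz uv by (intro exI[of _ v]) simp
  ultimately show "angle_sides G0 V hl h kl k" unfolding angle_sides_def by simp
qed


section \<open>The axioms\<close>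

lemma plane_incidence: "axiom_I1 G0" "axiom_I2 G0" "axiom_I3 G0"
proof -
  have "\<exists>l\<in>lines G0. A \<in> l \<and> B \<in> l" if "A \<noteq> B" for A B
  proof -
    have "line_at A (B - A) \<in> lines G0" using that line_at_in_lines by simp
    moreover have "A \<in> line_at A (B - A)" "B \<in> line_at A (B - A)"
      by (simp_all add: line_at_def cross_commute[of B A])
    ultimately show ?thesis by blast
  qed
  then show "axiom_I1 G0" unfolding axiom_I1_def by simp
  show "axiom_I2 G0"
    unfolding axiom_I2_def plane_simps(3) using line_at_two_points by (simp; metis)
  have "\<exists>A B. A \<noteq> B \<and> A \<in> l \<and> B \<in> l" if "l \<in> lines G0" for l
  proof -
    obtain V u where u: "u \<noteq> 0" "l = line_at V u" using \<open>l \<in> lines G0\<close> by auto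
    then have "V \<noteq> V + 1 *\<^sub>R u" "V \<in> l" "V + 1 *\<^sub>R u \<in> l" using line_at_add by (simp, simp, blast)
    then show ?thesis by blast
  qed
  moreover have "\<not> collinear3 G0 (0, 0) (1, 0) (0, 1)"
    by (simp add: collinear3_plane cross_def)
  moreover have "distinct [(0, 0), (1, 0), (0, 1) :: real \<times> real]" by simp
  ultimately show "axiom_I3 G0"
    unfolding axiom_I3_def plane_simps(1,3) by blast
qed

section \<open>Betweenness and the order axioms\<close>

lemma between_commute: "between A B C \<Longrightarrow> between C B A"
proof -
  assume "between A B C"
  then obtain t where t: "A \<noteq> C" "0 < t" "t < 1" "B = A + t *\<^sub>R (C - A)"
    unfolding between_def by blast
  then have "B = C + (1 - t) *\<^sub>R (A - C)" by (simp add: algebra_simps)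
  moreover have "0 < 1 - t" "1 - t < 1" using t by auto
  ultimately show "between C B A" using t unfolding between_def by blast
qed

text \<open>Substituting one parametrisation into the other makes a positive multiple of
  \<open>C - A\<close> vanish. With \<open>between_commute\<close> this excludes all three pairs in
  II.3.\<close>

lemma between_asym: "between A B C \<Longrightarrow> \<not> between B A C"
proof
  assume "between A B C" "between B A C"
  then obtain s t where s: "A \<noteq> C" "0 < s" "s < 1" "B = A + s *\<^sub>R (C - A)"
    and t: "0 < t" "t < 1" "A = B + t *\<^sub>R (C - B)"
    unfolding between_def by blast
  have "C - B = (1 - s) *\<^sub>R (C - A)" using s(4) by (simp add: algebra_simps)
  moreover have "A - B = t *\<^sub>R (C - B)" using t(3) by (simp add: algebra_simps)
  moreover have "A - B = - (s *\<^sub>R (C - A))" using s(4) by simp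
  ultimately have "(t * (1 - s)) *\<^sub>R (C - A) = - (s *\<^sub>R (C - A))"
    by (simp only: scaleR_scaleR)
  then have "(s + t * (1 - s)) *\<^sub>R (C - A) = 0"
    by (simp only: scaleR_add_left add.right_inverse)
  then have "s + t * (1 - s) = 0" using s(1) by simp
  moreover have "t * (1 - s) > 0" using s(3) t(1) by simp
  ultimately show False using s(2) by linarith
qed

lemma between_distinct: "between A B C \<Longrightarrow> distinct [A, B, C]"
proof -
  assume "between A B C"
  then obtain t where t: "A \<noteq> C" "0 < t" "t < 1" "B = A + t *\<^sub>R (C - A)"
    unfolding between_def by blast
  then have "C - B = (1 - t) *\<^sub>R (C - A)" by (simp add: algebra_simps)
  then show ?thesis using t by auto
qed

lemma plane_order: "axiom_II1 G0" "axiom_II2 G0" "axiom_II3 G0" "axiom_II4 G0"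
proof -
  have "collinear3 G0 A B C" if btw: "between A B C" for A B C
  proof -
    obtain t where "B = A + t *\<^sub>R (C - A)" using btw unfolding between_def by blast
    then have "B - A = t *\<^sub>R (C - A)" by simp
    then show ?thesis unfolding collinear3_plane by (simp only: cross_simps(1,9) mult_zero_right)
  qed
  then show "axiom_II1 G0"
    unfolding axiom_II1_def plane_simps using between_distinct between_commute by blast
  \<comment> \<open>The witness is the reflection of \<open>A\<close> in \<open>C\<close>.\<close>
  have "collinear3 G0 A C (C + (C - A)) \<and> between A C (C + (C - A))" if "A \<noteq> C" for A C
  proof
    show "collinear3 G0 A C (C + (C - A))" by (simp add: collinear3_plane cross_commute[of C A])
    have "C + (C - A) - A = 2 *\<^sub>R (C - A)" by (simp add: scaleR_2)
    then have "C = A + (1 / 2) *\<^sub>R (C + (C - A) - A)" "C + (C - A) - A \<noteq> 0" using that by simp_all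
    moreover from this have "A \<noteq> C + (C - A)" by (metis right_minus_eq)
    moreover have "(0::real) < 1 / 2" "1 / 2 < (1::real)" by simp_all
    ultimately show "between A C (C + (C - A))" unfolding between_def by blast
  qed
  then show "axiom_II2 G0" unfolding axiom_II2_def plane_simps by blast
  show "axiom_II3 G0"
    unfolding axiom_II3_def plane_simps using between_asym between_commute by blast
  have pasch: "(\<exists>P. P \<in> line_at V u \<and> between A P C) \<or> (\<exists>P. P \<in> line_at V u \<and> between B P C)"
    if "A \<notin> line_at V u" "B \<notin> line_at V u" "C \<notin> line_at V u"
      "\<exists>P. P \<in> line_at V u \<and> between A P B" for V u A B C
  proof -
    \<comment> \<open>Pasch reduces to signs: a nonzero \<open>r\<close> is opposite in sign to one
      of two numbers of opposite signs.\<close>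
    have sign: "p * r < 0 \<or> q * r < 0" if "p * q < 0" "r \<noteq> 0" for p q r :: real
      using that by (auto simp: mult_less_0_iff)
    have "cross u (A - V) * cross u (B - V) < 0" using that(4) between_line[OF that(1,2)] by (rule iffD1[rotated])
    moreover have "cross u (C - V) \<noteq> 0" using that(3) by (simp add: line_at_def)
    ultimately show ?thesis
      unfolding between_line[OF that(1,3)] between_line[OF that(2,3)] by (rule sign)
  qed
  have lines: "\<exists>V u. l = line_at V u" if "l \<in> lines G0" for l
    using that unfolding plane_simps by blast
  show "axiom_II4 G0"
    unfolding axiom_II4_def plane_simps(1,3,4)
  proof (intro ballI impI)
    fix A B C l
    assume asm: "l \<in> lines G0" "A \<notin> l" "B \<notin> l" "C \<notin> l" "\<exists>P\<in>UNIV. P \<in> l \<and> between A P B"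
    obtain V u where "l = line_at V u" using lines asm(1) by blast
    then show "(\<exists>P\<in>UNIV. P \<in> l \<and> between A P C) \<or> (\<exists>P\<in>UNIV. P \<in> l \<and> between B P C)"
      using pasch[of A V u B C] asm(2-5) by (simp only: bex_UNIV simp_thms)
  qed
qed

section \<open>Congruence of segments and of angles\<close>

lemma dist_between:
  assumes "between A B C"
  shows "dist A C = dist A B + dist B C"
proof -
  obtain t where t: "A \<noteq> C" "0 < t" "t < 1" "B = A + t *\<^sub>R (C - A)"
    using assms unfolding between_def by blast
  have "B - A = t *\<^sub>R (C - A)" "C - B = (1 - t) *\<^sub>R (C - A)" using t by (simp_all add: algebra_simps)
  then have "dist B A = t * dist C A" "dist C B = (1 - t) * dist C A"
    using t by (simp_all add: dist_norm)
  then have "dist C A = dist B A + dist C B" by (simp add: algebra_simps)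
  then show ?thesis by (simp add: dist_commute)
qed

lemma plane_segments: "axiom_III1 G0" "axiom_III2 G0" "axiom_III3 G0"
proof -
  have "\<exists>B'\<in>r. seg_cong G0 {A, B} {A', B'}" if AB: "A \<noteq> B" and r: "is_ray G0 A' l r" for A B A' l r
  proof -
    obtain u where u: "u \<noteq> 0" "r = ray_at A' u" using r unfolding is_ray_plane by blast
    \<comment> \<open>Scales the direction so that the new segment has the length of
      \<open>A\<close>, \<open>B\<close>.\<close>
    define t where "t = dist A B / norm u"
    have "t > 0" using AB u by (simp add: t_def)
    moreover have "dist A' (A' + t *\<^sub>R u) = dist A B" using AB u by (simp add: t_def dist_norm)
    ultimately show ?thesis using u unfolding seg_cong_plane ray_at_def
      by (intro bexI[of _ "A' + t *\<^sub>R u"]) auto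
  qed
  then show "axiom_III1 G0" unfolding axiom_III1_def by blast
  show "axiom_III2 G0" unfolding axiom_III2_def seg_cong_plane by metis
  show "axiom_III3 G0" unfolding axiom_III3_def seg_cong_plane plane_simps(4) using dist_between by metis
qed

lemma plane_angles: "axiom_III4 G0"
proof -
  have refl: "ang_cong G0 {h, k} {h, k}" if "angle_sides G0 V hl h kl k" for V hl h kl k
    using that has_measure_ray_at unfolding angle_sides_plane ang_cong_plane by metis
  have "\<exists>!k'. (\<exists>l. is_ray G0 V' l k') \<and> k' \<subseteq> S \<and> ang_cong G0 {h, k} {h', k'}"
    if hk: "angle_sides G0 V hl h kl k" and S: "is_side G0 a' S" and h': "is_ray G0 V' a' h'"
    for V hl h kl k a' S V' h'
  proof -
    obtain m where m: "has_measure {h, k} x \<longleftrightarrow> x = m" for x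
      using hk has_measure_ray_at unfolding angle_sides_plane by metis
    obtain u where u: "u \<noteq> 0" "a' = line_at V' u" "h' = ray_at V' u"
      using h' unfolding is_ray_plane by blast
    obtain s :: real where s: "\<bar>s\<bar> = 1" "S = {X. s * cross u (X - V') > 0}"
      using S is_side_plane u by blast
    \<comment> \<open>\<open>V'\<close> lies on the boundary line, so the direction alone decides
      whether the ray stays in the half-plane.\<close>
    have sub: "ray_at V' w \<subseteq> S \<longleftrightarrow> s * cross u w > 0" for w
    proof
      assume "ray_at V' w \<subseteq> S"
      moreover have "V' + 1 *\<^sub>R w \<in> ray_at V' w" by (rule ray_at_mem) simp
      ultimately have "V' + 1 *\<^sub>R w \<in> S" by blast
      then show "s * cross u w > 0" unfolding s by simp
    next
      assume pos: "s * cross u w > 0"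
      have "s * cross u (t *\<^sub>R w) > 0" if "t > 0" for t
        using mult_pos_pos[OF that pos] by (simp add: ac_simps)
      then show "ray_at V' w \<subseteq> S" unfolding s ray_at_def by auto
    qed
    have cong: "ang_cong G0 {h, k} {h', ray_at V' w} \<longleftrightarrow> cot_vec u w = m / weight V'"
      if "s * cross u w > 0" for w
    proof -
      have "cross u w \<noteq> 0" using that by auto
      then show ?thesis using m u has_measure_ray_at[of u w V']
        unfolding ang_cong_plane by (auto simp: eq_divide_eq mult.commute)
    qed
    \<comment> \<open>Dividing by the weight of the new vertex compensates its distortion, so the
      copied angle has measure \<open>m\<close>.\<close>
    define d where "d = ray_dir u s (m / weight V')"
    have "s * s = 1" using s(1) by (metis abs_mult_self_eq mult_1)
    then have d: "s * cross u d = inner u u" unfolding d_def cross_ray_dir by (metis mult.assoc mult_1)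
    then have dpos: "s * cross u d > 0" using u by simp
    show ?thesis
    proof (rule ex1I[of _ "ray_at V' d"])
      have "d \<noteq> 0" using dpos by auto
      then have "is_ray G0 V' (line_at V' d) (ray_at V' d)" unfolding is_ray_plane by blast
      then show "(\<exists>l. is_ray G0 V' l (ray_at V' d)) \<and> ray_at V' d \<subseteq> S \<and>
          ang_cong G0 {h, k} {h', ray_at V' d}"
        using sub cong dpos cot_vec_ray_dir u s unfolding d_def by blast
    next
      fix k' assume k': "(\<exists>l. is_ray G0 V' l k') \<and> k' \<subseteq> S \<and> ang_cong G0 {h, k} {h', k'}"
      then obtain w where "k' = ray_at V' w" unfolding is_ray_plane by blast
      then show "k' = ray_at V' d"
        using k' sub cong ray_at_ray_dir s unfolding d_def by metis
    qed
  qed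
  then show ?thesis unfolding axiom_III4_def using refl by blast
qed

text \<open>Two isosceles right triangles, translates of each other, agree in their legs and in the
  right angle, whose cotangent is 0. The half right angle at the origin has measure 2, its translate
  has measure 1.\<close>

lemma plane_not_SAS: "\<not> axiom_III5 G0"
proof
  assume SAS: "axiom_III5 G0"
  define A :: "real \<times> real" where "A = (1, 0)"
  define C :: "real \<times> real" where "C = (1, 1)"
  define A' :: "real \<times> real" where "A' = (2, 0)"
  define B' :: "real \<times> real" where "B' = (1, 0)"
  define C' :: "real \<times> real" where "C' = (2, 1)"
  note defs = A_def C_def A'_def B'_def C'_def
  have ne: "0 \<noteq> A" "C \<noteq> A" "A \<noteq> 0" "C \<noteq> 0" "B' \<noteq> A'" "C' \<noteq> A'" "A' \<noteq> B'" "C' \<noteq> B'"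
    by (simp_all add: defs prod_eq_iff)
  have "\<not> collinear3 G0 A 0 C" "\<not> collinear3 G0 A' B' C'"
    by (simp_all only: collinear3_plane) (simp_all add: defs cross_def)
  moreover have "seg_cong G0 {A, 0} {A', B'}" "seg_cong G0 {A, C} {A', C'}"
    unfolding seg_cong_plane by (simp_all add: defs dist_prod_def dist_real_def zero_prod_def)
  moreover have "ang_cong G0 (angle_pts G0 0 A C) (angle_pts G0 B' A' C')"
  proof -
    have "has_measure (angle_pts G0 0 A C) 0" "has_measure (angle_pts G0 B' A' C') 0"
      using ne unfolding angle_pts_def
      by (simp_all add: ray_thru_plane has_measure_ray_at defs cross_def cot_vec_def)
    then show ?thesis unfolding ang_cong_plane by blast
  qed
  ultimately have "ang_cong G0 (angle_pts G0 A 0 C) (angle_pts G0 A' B' C')"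
    using SAS unfolding axiom_III5_def by simp
  moreover have "has_measure (angle_pts G0 A 0 C) m \<longleftrightarrow> m = 2" for m
    using ne unfolding angle_pts_def
    by (simp add: ray_thru_plane has_measure_ray_at defs cross_def cot_vec_def weight_def)
  moreover have "has_measure (angle_pts G0 A' B' C') m \<longleftrightarrow> m = 1" for m
    using ne unfolding angle_pts_def
    by (simp add: ray_thru_plane has_measure_ray_at defs cross_def cot_vec_def weight_def zero_prod_def)
  ultimately show False unfolding ang_cong_plane by simp
qed

text \<open>Only incidence matters here, and the distortion leaves it unchanged: the parallel has
  the direction of \<open>a\<close>, and any other direction yields a meeting point.\<close>

lemma plane_cPF: "cPF G0"
proof -
  have "\<exists>!b. b \<in> lines G0 \<and> A \<in> b \<and> \<not> (\<exists>P. P \<in> a \<and> P \<in> b)" if "a \<in> lines G0" "A \<notin> a" for a A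
  proof -
    obtain V u where u: "u \<noteq> 0" "a = line_at V u" using \<open>a \<in> lines G0\<close> unfolding plane_simps by blast
    show ?thesis
    proof (rule ex1I[of _ "line_at A u"])
      have "line_at A u \<in> lines G0" using u unfolding plane_simps by blast
      moreover have "\<not> (\<exists>P. P \<in> a \<and> P \<in> line_at A u)"
        using line_at_shift u \<open>A \<notin> a\<close> line_at_base by metis
      ultimately show "line_at A u \<in> lines G0 \<and> A \<in> line_at A u \<and> \<not> (\<exists>P. P \<in> a \<and> P \<in> line_at A u)"
        by simp
    next
      fix b assume b: "b \<in> lines G0 \<and> A \<in> b \<and> \<not> (\<exists>P. P \<in> a \<and> P \<in> b)"
      then obtain w where w: "w \<noteq> 0" "b = line_at A w" using line_obtain by metis
      have "cross u w = 0" using b u w line_at_meet by blast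
      then obtain t where "w = t *\<^sub>R u" using u cross_eq_0_cases by blast
      then show "b = line_at A u" using w line_at_scale by (metis scale_zero_left)
    qed
  qed
  then show ?thesis unfolding cPF_def plane_simps(1,3) by simp
qed

section \<open>Comparison of angles and the failure of (PP)\<close>

lemma ray_in_angle_interior:
  assumes "cross u v \<noteq> 0" "cross u v * cross u w > 0" "cross v u * cross v w > 0"
  shows "ray_at V w \<subseteq> angle_interior G0 {ray_at V u, ray_at V v}"
proof
  fix P assume "P \<in> ray_at V w"
  then obtain t where t: "t > 0" "P = V + t *\<^sub>R w" unfolding ray_at_def by blast
  \<comment> \<open>One statement for both sides of the angle: positive parameters along the rays do
    not change the sign of the product.\<close>
  have side: "\<forall>K\<in>ray_at V b. same_side G0 (line_at V a) K P" if "cross a b * cross a w > 0" for a b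
  proof
    fix K assume "K \<in> ray_at V b"
    then obtain r where r: "r > 0" "K = V + r *\<^sub>R b" unfolding ray_at_def by blast
    have "(r * t) * (cross a b * cross a w) > 0" using r t that by simp
    then show "same_side G0 (line_at V a) K P" using r t by (simp add: same_side_plane ac_simps)
  qed
  have "angle_sides G0 V (line_at V u) (ray_at V u) (line_at V v) (ray_at V v)"
    unfolding angle_sides_plane using assms(1) by blast
  then show "P \<in> angle_interior G0 {ray_at V u, ray_at V v}"
    unfolding angle_interior_def using side[OF assms(2)] side[OF assms(3)] by blast
qed

text \<open>The larger cotangent belongs to the smaller angle, so the inequality between the
  measures is the reverse of that between the angles.\<close>

lemma angle_less_plane:
  assumes uv: "cross u v \<noteq> 0" and m: "has_measure \<alpha> m" "weight V * cot_vec u v < m"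
  shows "angle_less G0 \<alpha> {ray_at V u, ray_at V v}"
proof -
  define s where "s = sgn (cross u v)"
  define c where "c = m / weight V"
  \<comment> \<open>The direction on the side of \<open>u\<close> towards \<open>v\<close> that
    forms an angle of measure \<open>m\<close> with \<open>u\<close> at \<open>V\<close>.\<close>
  define w where "w = ray_dir u s c"
  have s: "\<bar>s\<bar> = 1" "\<bar>cross u v\<bar> = cross u v * s" using uv by (simp_all add: s_def abs_sgn_eq abs_sgn)
  have u: "u \<noteq> 0" using uv by auto
  have "cot_vec u v < c" using m by (simp add: c_def less_divide_eq mult.commute)
  then have c: "inner u v < c * \<bar>cross u v\<bar>" using uv by (simp add: cot_vec_def divide_less_eq)
  have "cross u v * cross u w = \<bar>cross u v\<bar> * inner u u"
    unfolding w_def cross_ray_dir s by simp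
  then have 1: "cross u v * cross u w > 0" using uv u by simp
  \<comment> \<open>The last factor shows that \<open>w\<close> is on the right side of
    \<open>v\<close> exactly because its cotangent \<open>c\<close> exceeds that of
    \<open>v\<close>.\<close>
  have "cross v u * cross v w = \<bar>cross u v\<bar> * (c * \<bar>cross u v\<bar> - inner u v)"
  proof -
    have "cross v u * cross v w = c * (cross u v * cross u v) - (cross u v * s) * inner u v"
      by (simp add: w_def ray_dir_def cross_commute[of v u] inner_commute algebra_simps)
    then show ?thesis unfolding s(2)[symmetric] by (simp add: algebra_simps)
  qed
  then have 2: "cross v u * cross v w > 0" using uv c by simp
  have sides: "angle_sides G0 V (line_at V u) (ray_at V u) (line_at V v) (ray_at V v)"
    unfolding angle_sides_plane using uv by blast
  have w: "cross u w \<noteq> 0" using 1 by auto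
  then have ray: "is_ray G0 V (line_at V w) (ray_at V w)"
    unfolding is_ray_plane by (intro exI[of _ w]) auto
  have "has_measure {ray_at V u, ray_at V w} m"
    using w u s by (simp add: has_measure_ray_at w_def cot_vec_ray_dir c_def)
  then have "ang_cong G0 {ray_at V u, ray_at V w} \<alpha>" using m unfolding ang_cong_plane by blast
  then show ?thesis
    unfolding angle_less_def using sides ray ray_in_angle_interior[OF uv 1 2] by blast
qed

text \<open>Either side of the angle may be the common one. The remaining sides are distinct rays of
  one line from one point, so their directions differ by a negative factor.\<close>

lemma supplementary_plane:
  assumes uv: "cross u v \<noteq> 0" and sup: "supplementary G0 {ray_at V u, ray_at V v} \<beta>"
  shows "\<beta> = {ray_at V u, ray_at V (- v)} \<or> \<beta> = {ray_at V v, ray_at V (- u)}"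
proof -
  have nz: "u \<noteq> 0" "v \<noteq> 0" using uv by auto
  obtain W hl h kl k k' where sd: "angle_sides G0 W hl h kl k" "angle_sides G0 W hl h kl k'"
    "k \<noteq> k'" "{ray_at V u, ray_at V v} = {h, k}" "\<beta> = {h, k'}"
    using sup unfolding supplementary_def by blast
  obtain a b where ab: "a \<noteq> 0" "b \<noteq> 0" "kl = line_at W a" "k = ray_at W a" "kl = line_at W b" "k' = ray_at W b"
    using sd(1,2) unfolding angle_sides_def is_ray_plane by blast
  have "cross a b = 0" using ab line_at_eq_cross by metis
  then obtain t where t: "b = t *\<^sub>R a" using ab cross_eq_0_cases by blast
  have "\<not> t > 0" using t ab sd(3) ray_at_scale by metis
  moreover have "t \<noteq> 0" using t ab by auto
  ultimately have "- t > 0" by simp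
  then have "ray_at W ((- t) *\<^sub>R (- a)) = ray_at W (- a)" by (rule ray_at_scale)
  then have k': "k' = ray_at W (- a)" using ab(6) t by simp
  have opp: "k' = ray_at V (- x)" if x: "k = ray_at V x" "x \<noteq> 0" for x
  proof -
    obtain c where c: "V = W" "c > 0" "a = c *\<^sub>R x"
      using x(1) ab(4) ray_at_eq_iff[OF x(2) ab(1), of V W] by auto
    then have "ray_at V (- a) = ray_at V (- x)" using ray_at_scale[of c V "- x"] by simp
    then show ?thesis using k' c(1) by simp
  qed
  from sd(4) consider "h = ray_at V u" "k = ray_at V v" | "h = ray_at V v" "k = ray_at V u"
    unfolding doubleton_eq_iff by metis
  then show ?thesis using opp nz sd(5) by cases auto
qed

text \<open>Reversing a side negates the cotangent, and the vertex keeps its weight. So the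
  comparison with a supplement asks whether the two measures have a positive sum.\<close>

lemma angle_less_supplement:
  assumes uv: "cross u v \<noteq> 0" and m: "has_measure \<alpha> m" "- (weight V * cot_vec u v) < m"
    and sup: "supplementary G0 {ray_at V u, ray_at V v} \<beta>"
  shows "angle_less G0 \<alpha> \<beta>"
proof -
  have "cot_vec u (- v) = - cot_vec u v" "cot_vec v (- u) = - cot_vec u v"
    by (simp_all add: cot_vec_def inner_commute cross_commute[of v u])
  then have "weight V * cot_vec u (- v) < m" "weight V * cot_vec v (- u) < m"
    using m by simp_all
  moreover have "cross u (- v) \<noteq> 0" "cross v (- u) \<noteq> 0" using uv by (simp_all add: cross_commute[of v u])
  ultimately show ?thesis
    using supplementary_plane[OF uv sup] angle_less_plane m by blast
qed

text \<open>Two parallels of slope 1, one through the origin, are cut by the vertical axis. The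
  interior angles on the right have cotangents 1 and -1, which cancel; doubling the first gives
  measures 2 and -1 with positive sum.\<close>

lemma plane_not_PP: "\<not> PP G0"
proof
  assume PP: "PP G0"
  define B :: "real \<times> real" where "B = (0, 1)"
  define d :: "real \<times> real" where "d = (1, 1)"
  define a where "a = line_at 0 d"
  define b where "b = line_at B d"
  define t where "t = line_at 0 B"
  define S where "S = {Q. same_side G0 t d Q}"
  have nz: "B \<noteq> 0" "d \<noteq> 0" by (simp_all add: B_def d_def prod_eq_iff)
  have cr: "cross B d = - 1" by (simp add: B_def d_def cross_def)
  then have cr': "cross d B = 1" using cross_commute[of d B] by simp
  have lines: "a \<in> lines G0" "b \<in> lines G0" "t \<in> lines G0"
    using nz unfolding a_def b_def t_def plane_simps by blast+
  have on: "0 \<in> a" "0 \<in> t" "B \<in> b" "B \<in> t" by (simp_all add: a_def b_def t_def line_at_def)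
  have disj: "\<not> (P \<in> a \<and> P \<in> b)" for P
    using cr' by (auto simp: a_def b_def line_at_def)
  have "d \<in> a" "B + d \<in> b" "d \<notin> t" "B + d \<notin> t"
    using cr by (simp_all add: a_def b_def t_def line_at_def)
  then have neq: "a \<noteq> b" "t \<noteq> a" "t \<noteq> b" using on disj by blast+
  have side: "is_side G0 t S"
    unfolding is_side_def S_def using lines \<open>d \<notin> t\<close> by auto
  have rays: "is_ray G0 0 a (ray_at 0 d)" "is_ray G0 B b (ray_at B d)"
    using nz unfolding is_ray_plane a_def b_def by blast+
  have sub: "ray_at 0 d \<subseteq> S" "ray_at B d \<subseteq> S"
    using cr by (auto simp: ray_at_def S_def t_def same_side_plane)
  have thru: "ray_thru G0 0 B = ray_at 0 B" "ray_thru G0 B 0 = ray_at B (- B)"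
    using nz by (simp_all add: ray_thru_plane)
  have cot: "cot_vec B d = 1" "cot_vec (- B) d = - 1"
    by (simp_all add: B_def d_def cot_vec_def cross_def)
  have w: "weight 0 = 2" "weight B = 1" using nz by (simp_all add: weight_def)
  have meas: "has_measure {ray_at 0 B, ray_at 0 d} 2" "has_measure {ray_at B (- B), ray_at B d} (- 1)"
    using cr cot w by (simp_all add: has_measure_ray_at)
  \<comment> \<open>The two inequalities needed are 1 < 2 for the supplements at \<open>B\<close>
    and -2 < -1 for those at the origin.\<close>
  have "less_than_two_right G0 {ray_thru G0 0 B, ray_at 0 d} {ray_thru G0 B 0, ray_at B d}"
    unfolding less_than_two_right_def thru
    using angle_less_supplement[of "- B" d _ 2 B] angle_less_supplement[of B d _ "- 1" 0] meas cr cot w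
    by simp
  then have "\<exists>P\<in>S. P \<in> a \<and> P \<in> b"
    using PP[unfolded PP_def plane_simps(1,3)] lines neq on nz side rays sub by blast
  then show False using disj by blast
qed

theorem mainTheorem1:
  "\<not> (\<forall>G :: (real \<times> real, (real \<times> real) set) geometry.
        satisfies_I_II_III14 G \<longrightarrow> (PP G \<longleftrightarrow> cPF G)) \<and>
   (\<exists>G :: (real \<times> real, (real \<times> real) set) geometry.
        satisfies_I_II_III14 G \<and> \<not> axiom_III5 G \<and> cPF G \<and> \<not> PP G)"
proof -
  have "satisfies_I_II_III14 G0"
    using plane_incidence plane_order plane_segments plane_angles
    by (simp add: satisfies_I_II_III14_def)
  then have model: "satisfies_I_II_III14 G0 \<and> \<not> axiom_III5 G0 \<and> cPF G0 \<and> \<not> PP G0"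
    using plane_not_SAS plane_cPF plane_not_PP by simp
  show ?thesis
  proof
    show "\<not> (\<forall>G :: (real \<times> real, (real \<times> real) set) geometry.
        satisfies_I_II_III14 G \<longrightarrow> (PP G \<longleftrightarrow> cPF G))"
      using model by metis
  next
    show "\<exists>G :: (real \<times> real, (real \<times> real) set) geometry.
        satisfies_I_II_III14 G \<and> \<not> axiom_III5 G \<and> cPF G \<and> \<not> PP G"
      using model by (rule exI)
  qed
qed

end
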